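(* Let $d\ge 1$, let $\mathcal{P}=(P_i)_{i\ge 0}$ be a probability distribution on $\{0,1,2,\dots\}$, and for $x\in\mathbb{Z}^d$ let $(\delta_t^x)_{t\ge 0}$ be the periodic nearest-neighbors branching random walk on $\mathbb{Z}^d$ with offspring distribution $\mathcal{P}$ initiated by a single particle at $x$. For $n\ge 1$ and $x\in\mathring{\Lambda}_n^d$ let $$\tau_n^x=\inf\{t:\ \delta_t^x(z)\ge 1\text{ for some } z\in\partial\Lambda_n^d\},\qquad p_n(x)=\mathbb{P}(\tau_n^x<\infty).$$ Then for all $n\ge 1$ and all $x,y\in\mathbb{Z}_+^d\cap\mathring{\Lambda}_n^d$, $$x\preceq y\ \Longrightarrow\ p_n(x)\le p_n(y).$$
   Context: Periodic nearest-neighbors branching random walk with offspring distribution $\mathcal{P}$: the discrete-time particle system on $\mathbb{Z}^d$ in which every particle, independently of the other particles, generates a random number of offspring distributed according to $\mathcal{P}$ and dies after one time unit; each offspring particle is placed (independently) at a site chosen uniformly at random from the $2d$ nearest neighbors of the site of the parent. $\delta_t(z)$ is the number of particles at site $z$ at time $t\in\{0,1,2,\dots\}$. Notation: $\|x\|=\max_i|x_i|$; $\Lambda_n^d=\{x\in\mathbb{Z}^d:\|x\|\le n\}$; $\partial\Lambda_n^d=\{x\in\Lambda_n^d:\|x\|=n\}$; $\mathring{\Lambda}_n^d=\Lambda_n^d\setminus\partial\Lambda_n^d$. $\mathbb{Z}_+^d$ is the set of points of $\mathbb{Z}^d$ with all coordinates $\ge 0$. For $x,y\in\mathbb{Z}_+^d$,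 $x\preceq y$ means $x_i\le y_i$ for all $i=1,\dots,d$. Convention: $\inf\emptyset=\infty$. *)

theory Defs
  imports "HOL-Probability.Probability" "HOL-Library.Extended_Nat"
begin

section \<open>Boxes in the integer lattice\<close>

definition supnorm :: "int ^ 'd \<Rightarrow> int" where
  "supnorm x = Max (range (\<lambda>i. \<bar>x $ i\<bar>))"

definition box_lattice :: "nat \<Rightarrow> (int ^ 'd) set" where
  "box_lattice n = {x. supnorm x \<le> int n}"

definition box_boundary :: "nat \<Rightarrow> (int ^ 'd) set" where
  "box_boundary n = {x \<in> box_lattice n. supnorm x = int n}"

definition box_interior :: "nat \<Rightarrow> (int ^ 'd) set" where
  "box_interior n = box_lattice n - box_boundary n"

definition nonneg_orthant :: "(int ^ 'd) set" where
  "nonneg_orthant = {x. \<forall>i. 0 \<le> x $ i}"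

definition unit_steps :: "(int ^ 'd) set" where
  "unit_steps = range (\<lambda>i. axis i 1) \<union> range (\<lambda>i. axis i (- 1))"

lemma finite_unit_steps: "finite (unit_steps :: (int ^ 'd) set)"
  by (simp add: unit_steps_def)

lemma card_unit_steps: "card (unit_steps :: (int ^ 'd) set) = 2 * CARD('d)"
proof -
  have "inj (\<lambda>i::'d. axis i (1::int))" "inj (\<lambda>i::'d. axis i (- 1 :: int))"
    by (auto simp: inj_def axis_eq_axis)
  moreover have "range (\<lambda>i::'d. axis i (1::int)) \<inter> range (\<lambda>i. axis i (- 1)) = {}"
    by (auto simp: axis_eq_axis)
  ultimately show ?thesis
    unfolding unit_steps_def by (subst card_Un_disjoint) (auto simp: card_image)
qed

lemma unit_steps_nonempty: "(unit_steps :: (int ^ 'd) set) \<noteq> {}"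
  by (simp add: unit_steps_def)


section \<open>Branching random walk\<close>

text \<open>
  Potential particles carry Ulam--Harris labels, most recent index first: the empty word is the
  initial particle and \<open>j # u\<close> is the offspring number \<open>j\<close> (counted from 0) of the particle \<open>u\<close>.
  An outcome \<open>\<omega>\<close> gives each label \<open>u\<close> an offspring number \<open>fst (\<omega> u)\<close> and the displacement
  \<open>snd (\<omega> u)\<close> from its parent; these are all independent. The displacement of the empty word is
  never used. A particle with label \<open>u\<close> is present at time \<open>length u\<close> only.
\<close>

type_synonym 'd brw_outcome = "nat list \<Rightarrow> nat \<times> (int ^ 'd)"

definition brw_space :: "nat pmf \<Rightarrow> ('d::finite) brw_outcome measure" where
  "brw_space P = (\<Pi>\<^sub>M u\<in>UNIV. measure_pmf (pair_pmf P (pmf_of_set unit_steps)))"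

primrec born :: "('d::finite) brw_outcome \<Rightarrow> nat list \<Rightarrow> bool" where
  "born \<omega> [] \<longleftrightarrow> True"
| "born \<omega> (j # u) \<longleftrightarrow> born \<omega> u \<and> j < fst (\<omega> u)"

primrec site :: "int ^ 'd \<Rightarrow> ('d::finite) brw_outcome \<Rightarrow> nat list \<Rightarrow> int ^ 'd" where
  "site x \<omega> [] = x"
| "site x \<omega> (j # u) = site x \<omega> u + snd (\<omega> (j # u))"

definition brw :: "int ^ 'd \<Rightarrow> ('d::finite) brw_outcome \<Rightarrow> nat \<Rightarrow> int ^ 'd \<Rightarrow> nat" where
  "brw x \<omega> t z = card {u. length u = t \<and> born \<omega> u \<and> site x \<omega> u = z}"

text \<open>In \<^typ>\<open>enat\<close>, \<open>Inf {} = \<infinity>\<close>.\<close>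

definition hitting_time :: "nat \<Rightarrow> int ^ 'd \<Rightarrow> ('d::finite) brw_outcome \<Rightarrow> enat" where
  "hitting_time n x \<omega> = Inf {enat t | t. \<exists>z \<in> box_boundary n. brw x \<omega> t z \<ge> 1}"

definition hitting_prob :: "nat pmf \<Rightarrow> nat \<Rightarrow> int ^ 'd \<Rightarrow> real" where
  "hitting_prob P n x =
     measure (brw_space P) {\<omega> \<in> space (brw_space P). hitting_time n x \<omega> < \<infinity>}"


subsection \<open>Well-definedness\<close>

lemma prob_space_brw_space: "prob_space (brw_space P)"
  unfolding brw_space_def by (intro prob_space_PiM prob_space_measure_pmf)

lemma finite_generation: "finite {u. length u = t \<and> born \<omega> u}"
proof (induction t)
  case 0
  have "{u. length u = 0 \<and> born \<omega> u} = {[]}" by auto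
  then show ?case by simp
next
  case (Suc t)
  have "{u. length u = Suc t \<and> born \<omega> u} \<subseteq>
      (\<Union>u \<in> {u. length u = t \<and> born \<omega> u}. (\<lambda>j. j # u) ` {..<fst (\<omega> u)})"
    by (auto simp: length_Suc_conv)
  then show ?case
    using Suc by (rule finite_subset[OF _ finite_UN_I]) auto
qed

lemma brw_ge_1_iff: "brw x \<omega> t z \<ge> 1 \<longleftrightarrow> (\<exists>u. length u = t \<and> born \<omega> u \<and> site x \<omega> u = z)"
proof -
  have "finite {u. length u = t \<and> born \<omega> u \<and> site x \<omega> u = z}"
    by (rule finite_subset[OF _ finite_generation[of t \<omega>]]) auto
  then show ?thesis
    unfolding brw_def by (auto simp: Suc_le_eq card_gt_0_iff)
qed

lemma hitting_time_finite_iff: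
  "hitting_time n x \<omega> < \<infinity> \<longleftrightarrow> (\<exists>u. born \<omega> u \<and> site x \<omega> u \<in> box_boundary n)"
proof -
  have "hitting_time n x \<omega> < \<infinity> \<longleftrightarrow> (\<exists>t. \<exists>z \<in> box_boundary n. brw x \<omega> t z \<ge> 1)"
    unfolding hitting_time_def Inf_less_iff by auto
  also have "\<dots> \<longleftrightarrow> (\<exists>u. born \<omega> u \<and> site x \<omega> u \<in> box_boundary n)"
    unfolding brw_ge_1_iff by blast
  finally show ?thesis .
qed

lemma measurable_component: "(\<lambda>\<omega>. \<omega> u) \<in> brw_space P \<rightarrow>\<^sub>M count_space UNIV"
proof -
  have "(\<lambda>\<omega>. \<omega> u) \<in> brw_space P \<rightarrow>\<^sub>M measure_pmf (pair_pmf P (pmf_of_set unit_steps))"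
    unfolding brw_space_def by (rule measurable_component_singleton) simp
  then show ?thesis
    by (simp cong: measurable_cong_sets)
qed

lemma measurable_born: "(\<lambda>\<omega> :: ('d::finite) brw_outcome. born \<omega> u) \<in> brw_space P \<rightarrow>\<^sub>M count_space UNIV"
proof (induction u)
  case (Cons j u)
  have "(\<lambda>\<omega> :: 'd brw_outcome. j < fst (\<omega> u)) \<in> brw_space P \<rightarrow>\<^sub>M count_space UNIV"
    by (rule measurable_compose[OF measurable_component]) simp
  with Cons show ?case by (auto intro: pred_intros_logic)
qed simp

lemma measurable_site: "(\<lambda>\<omega> :: ('d::finite) brw_outcome. site x \<omega> u) \<in> brw_space P \<rightarrow>\<^sub>M count_space UNIV"
proof (induction u)
  case (Cons j u)
  have snd: "(\<lambda>\<omega> :: 'd brw_outcome. snd (\<omega> (j # u))) \<in> brw_space P \<rightarrow>\<^sub>M count_space UNIV"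
    by (rule measurable_compose[OF measurable_component]) simp
  have "(\<lambda>\<omega>. (\<lambda>v. site x \<omega> u + v) (snd (\<omega> (j # u)))) \<in> brw_space P \<rightarrow>\<^sub>M count_space UNIV"
    by (rule measurable_compose_countable[OF measurable_compose[OF Cons] snd]) simp
  then show ?case by simp
qed simp

lemma sets_hitting:
  fixes x :: "int ^ 'd"
  shows "{\<omega> \<in> space (brw_space P). hitting_time n x \<omega> < \<infinity>} \<in> sets (brw_space P)"
proof -
  have [measurable]: "Measurable.pred (brw_space P) (\<lambda>\<omega> :: 'd brw_outcome. born \<omega> u)" for u
    by (rule measurable_born)
  have [measurable]: "Measurable.pred (brw_space P) (\<lambda>\<omega>. site x \<omega> u \<in> box_boundary n)" for u
    by (rule measurable_compose[OF measurable_site]) simp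
  show ?thesis
    unfolding hitting_time_finite_iff by measurable
qed

end

theory Submission
  imports Defs
begin

text \<open>
  Let \<open>u x\<close> be the probability that the branching random walk from \<open>x\<close> never reaches the boundary of
  the box; put \<open>u = 0\<close> outside the interior. The theorem says that \<open>u\<close> decreases along the order of the
  orthant. Splitting the family tree at the root shows that inside the box
  \<open>u x = G (average of u over the neighbours of x)\<close>, where \<open>G\<close> is the generating function of the offspring
  law (\<open>prob_avoid\<close> and \<open>prob_avoid_after_step\<close>). The rest of the argument is analysis
  of this equation with boundary value 0.

  Let \<open>q\<close> be the least fixed point of \<open>G\<close> in \<open>[0, 1]\<close>. By convexity, \<open>G s \<le> s\<close> above \<open>q\<close>, and \<open>G\<close> is
  1-Lipschitz on \<open>[0, q]\<close> (\<open>least_fixed_point_of_convex\<close>). A maximum principle gives \<open>u \<le> q\<close>. Hence the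
  values of \<open>u\<close> at two interior sites differ by at most the difference of the averages of \<open>u\<close> around
  these sites, and the maximum principle applies to differences of \<open>u\<close> as well. Consequently \<open>u\<close> is invariant under
  reflection of a coordinate, and \<open>u (x + axis i 1) - u x\<close> cannot be positive when \<open>0 \<le> x $ i\<close>
  (\<open>fixed_point_monotone\<close>). The bound \<open>u \<le> q\<close> is essential: for a supercritical law, \<open>G\<close> expands
  distances near 1.

  A coupling of the walks from two neighbouring sites would have to overcome that their positions
  at equal times have different parity. The maximum principle for \<open>u\<close>, in which time no longer appears, avoids
  this difficulty.
\<close>

section \<open>Probability generating functions\<close>

lemma convex_on_power_unit_interval: "convex_on {0..1::real} (\<lambda>s. s ^ k)"
proof -
  have "convex_on {0::real..} (\<lambda>s. s ^ k)"
    using convex_power_even[of k] convex_power_odd[of k]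
    by (cases "even k") (auto intro: convex_on_subset)
  then show ?thesis
    by (rule convex_on_subset) auto
qed

definition pgf :: "nat pmf \<Rightarrow> real \<Rightarrow> real" where
  "pgf P s = measure_pmf.expectation P (\<lambda>k. s ^ k)"

lemma integrable_power_pmf:
  fixes s :: real
  assumes "0 \<le> s" "s \<le> 1"
  shows "integrable (measure_pmf P) (\<lambda>k. s ^ k)"
  using assms by (intro measure_pmf.integrable_const_bound[where B = 1]) (auto intro: power_le_one)

lemma pgf_sums:
  assumes "0 \<le> s" "s \<le> 1"
  shows "(\<lambda>k. pmf P k * s ^ k) sums pgf P s"
proof -
  have "integrable (count_space UNIV) (\<lambda>k. pmf P k *\<^sub>R s ^ k)"
    using integrable_power_pmf[OF assms, of P] unfolding measure_pmf_eq_density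
    by (subst (asm) integrable_density) auto
  then have "(\<lambda>k. pmf P k *\<^sub>R s ^ k) sums (\<integral>k. pmf P k *\<^sub>R s ^ k \<partial>count_space UNIV)"
    by (rule sums_integral_count_space_nat)
  also have "(\<integral>k. pmf P k *\<^sub>R s ^ k \<partial>count_space UNIV) = pgf P s"
    unfolding pgf_def measure_pmf_eq_density by (subst integral_density) auto
  finally show ?thesis by simp
qed

lemma pgf_mono: "0 \<le> s \<Longrightarrow> s \<le> t \<Longrightarrow> t \<le> 1 \<Longrightarrow> pgf P s \<le> pgf P t"
  unfolding pgf_def by (intro integral_mono integrable_power_pmf power_mono) auto

lemma pgf_nonneg: "0 \<le> s \<Longrightarrow> 0 \<le> pgf P s"
  unfolding pgf_def by simp

lemma pgf_1: "pgf P 1 = 1"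
  by (simp add: pgf_def)

lemma convex_on_pgf: "convex_on {0..1} (pgf P)"
proof (intro convex_onI)
  fix t x y :: real
  assume t: "0 < t" "t < 1" and xy: "x \<in> {0..1}" "y \<in> {0..1}"
  have mid: "(1 - t) *\<^sub>R x + t *\<^sub>R y \<in> {0..1}"
    using t xy convexD[OF convex_closed_interval[of 0 "1::real"], of x y "1 - t" t] by auto
  have "pgf P ((1 - t) *\<^sub>R x + t *\<^sub>R y)
      \<le> measure_pmf.expectation P (\<lambda>k. (1 - t) * x ^ k + t * y ^ k)"
    unfolding pgf_def
  proof (rule integral_mono)
    show "integrable (measure_pmf P) (\<lambda>k. ((1 - t) *\<^sub>R x + t *\<^sub>R y) ^ k)"
      using mid by (intro integrable_power_pmf) auto
    show "integrable (measure_pmf P) (\<lambda>k. (1 - t) * x ^ k + t * y ^ k)"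
      using xy by (intro Bochner_Integration.integrable_add integrable_mult_right integrable_power_pmf) auto
    show "((1 - t) *\<^sub>R x + t *\<^sub>R y) ^ k \<le> (1 - t) * x ^ k + t * y ^ k" for k
      using convex_onD[OF convex_on_power_unit_interval] t xy by simp
  qed
  also have "\<dots> = (1 - t) * pgf P x + t * pgf P y"
    using xy unfolding pgf_def
    by (subst Bochner_Integration.integral_add) (auto intro!: integrable_mult_right integrable_power_pmf)
  finally show "pgf P ((1 - t) *\<^sub>R x + t *\<^sub>R y) \<le> (1 - t) * pgf P x + t * pgf P y" .
qed simp

text \<open>
  For the generating function of the offspring law, \<open>q\<close> is the extinction probability. The graph of a
  convex \<open>G\<close> lies below the chord from \<open>(q, q)\<close> to \<open>(1, 1)\<close> on \<open>[q, 1]\<close>. On \<open>[0, q]\<close> it lies above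
  the diagonal and meets it at \<open>q\<close>, so its chords ending at \<open>q\<close> have slope at most 1; slopes of chords
  increase to the right, so all chords within \<open>[0, q]\<close> have slope at most 1.
\<close>
lemma least_fixed_point_of_convex:
  fixes G :: "real \<Rightarrow> real"
  assumes cvx: "convex_on {0..1} G"
    and mono: "\<And>s t. 0 \<le> s \<Longrightarrow> s \<le> t \<Longrightarrow> t \<le> 1 \<Longrightarrow> G s \<le> G t"
    and G0: "0 \<le> G 0" and G1: "G 1 = 1"
  obtains q where "0 \<le> q" "q \<le> 1"
    "\<And>s. q \<le> s \<Longrightarrow> s \<le> 1 \<Longrightarrow> G s \<le> s"
    "\<And>s t. 0 \<le> s \<Longrightarrow> s \<le> t \<Longrightarrow> t \<le> q \<Longrightarrow> G t - G s \<le> t - s"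
proof -
  \<comment> \<open>As in the Knaster--Tarski theorem, monotonicity makes this infimum the least fixed point.\<close>
  define A where "A = {s. 0 \<le> s \<and> s \<le> 1 \<and> G s \<le> s}"
  define q where "q = Inf A"
  have "1 \<in> A" by (simp add: A_def G1)
  have bdd: "bdd_below A" by (rule bdd_belowI[of _ 0]) (simp add: A_def)
  have q0: "0 \<le> q" unfolding q_def using \<open>1 \<in> A\<close> by (intro cInf_greatest) (auto simp: A_def)
  have q1: "q \<le> 1" unfolding q_def using \<open>1 \<in> A\<close> bdd by (rule cInf_lower)
  have "G q \<le> q"
    unfolding q_def
  proof (rule cInf_greatest)
    fix s assume s: "s \<in> A"
    then have "q \<le> s" unfolding q_def using bdd by (rule cInf_lower)
    then have "G q \<le> G s" using s q0 by (intro mono) (auto simp: A_def)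
    then show "G (Inf A) \<le> s" using s by (auto simp: A_def q_def)
  qed (use \<open>1 \<in> A\<close> in auto)
  have above: "s \<le> G s" if "0 \<le> s" "s \<le> q" for s
  proof (cases "s = q")
    case True
    have "0 \<le> G q" using G0 mono[of 0 q] q0 q1 by simp
    moreover have "G (G q) \<le> G q" using \<open>G q \<le> q\<close> \<open>0 \<le> G q\<close> q1 by (intro mono)
    ultimately have "G q \<in> A" using \<open>G q \<le> q\<close> q1 by (simp add: A_def)
    then have "q \<le> G q" unfolding q_def using bdd by (rule cInf_lower)
    then show ?thesis using True by simp
  next
    case False
    then have "s \<notin> A" using that cInf_lower[OF _ bdd, of s] by (auto simp: q_def)
    then show ?thesis using that q1 by (simp add: A_def)
  qed
  have fixp: "G q = q" using \<open>G q \<le> q\<close> above[of q] q0 by simp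
  have below: "G s \<le> s" if "q \<le> s" "s \<le> 1" for s
  proof (cases "q < s \<and> s < 1")
    case True
    have "(G q - G 1) / (q - 1) \<le> (G s - G 1) / (s - 1)"
      using True q0 by (intro convex_on_slope_le(2)[OF cvx]) auto
    then have "1 \<le> (G s - 1) / (s - 1)" using True fixp G1 by simp
    then show ?thesis using True by (simp add: field_simps)
  next
    case False
    then have "s = q \<or> s = 1" using that by auto
    then show ?thesis using fixp G1 by auto
  qed
  have lip: "G t - G s \<le> t - s" if st: "0 \<le> s" "s \<le> t" "t \<le> q" for s t
  proof -
    consider "s = t" | "s < t" "t = q" | "s < t" "t < q" using st by linarith
    then show ?thesis
    proof cases
      case 3
      have "(G s - G t) / (s - t) \<le> (G s - G q) / (s - q)"
        using 3 st q1 by (intro convex_on_slope_le(1)[OF cvx]) auto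
      also have "\<dots> \<le> 1"
        using 3 above[of s] st fixp by (simp add: divide_le_eq)
      finally show ?thesis using 3 by (simp add: divide_le_eq)
    qed (use above[of s] st fixp in auto)
  qed
  show thesis using that[OF q0 q1 below lip] .
qed

section \<open>Averages over neighbours and the maximum principle\<close>

definition nbr_avg :: "(int ^ 'd \<Rightarrow> real) \<Rightarrow> int ^ 'd::finite \<Rightarrow> real" where
  "nbr_avg f x = (\<Sum>s\<in>unit_steps. f (x + s)) / real (card (unit_steps :: (int ^ 'd) set))"

lemma card_unit_steps_pos: "0 < card (unit_steps :: (int ^ 'd::finite) set)"
  by (simp add: card_gt_0_iff finite_unit_steps unit_steps_nonempty)

lemma nbr_avg_diff: "nbr_avg (\<lambda>x. f x - g x) x = nbr_avg f x - nbr_avg g x"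
  by (simp add: nbr_avg_def sum_subtractf diff_divide_distrib)

lemma nbr_avg_const: "nbr_avg (\<lambda>_. c) (x :: int ^ 'd::finite) = c"
  using card_unit_steps_pos[where 'd = 'd] by (simp add: nbr_avg_def)

lemma nbr_avg_mono:
  "(\<And>s. s \<in> unit_steps \<Longrightarrow> f (x + s) \<le> g (x + s)) \<Longrightarrow> nbr_avg f x \<le> nbr_avg g x"
  unfolding nbr_avg_def by (intro divide_right_mono sum_mono) auto

text \<open>
  Take a positive maximum, and among the sites
  attaining it one whose \<open>i\<close>-th coordinate is largest. Its neighbour one step further in direction
  \<open>i\<close> has a strictly smaller value, so the average over the neighbours is strictly below the maximum.
\<close>
lemma discrete_maximum_principle:
  fixes h :: "int ^ 'd::finite \<Rightarrow> real"
  assumes fin: "finite S" and out: "\<And>x. x \<notin> S \<Longrightarrow> h x \<le> 0"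
    and sub: "\<And>x. x \<in> S \<Longrightarrow> 0 < h x \<Longrightarrow> h x \<le> nbr_avg h x"
  shows "h x \<le> 0"
proof (rule ccontr)
  assume "\<not> h x \<le> 0"
  then have "x \<in> S" "0 < h x" using out[of x] by auto
  define M where "M = Max (h ` S)"
  have le_M: "h z \<le> M" if "z \<in> S" for z
    unfolding M_def using fin that by simp
  have "0 < M" using le_M[OF \<open>x \<in> S\<close>] \<open>0 < h x\<close> by simp
  have le_M': "h z \<le> M" for z
    using le_M[of z] out[of z] \<open>0 < M\<close> by (cases "z \<in> S") auto
  define T where "T = {z \<in> S. h z = M}"
  have "M \<in> h ` S" unfolding M_def using fin \<open>x \<in> S\<close> by (intro Max_in) auto
  then have "T \<noteq> {}" by (auto simp: T_def)
  have "finite T" using fin by (simp add: T_def)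
  fix i :: 'd
  obtain z where z: "z \<in> T" "\<And>w. w \<in> T \<Longrightarrow> w $ i \<le> z $ i"
    using Max_in[of "(\<lambda>z. z $ i) ` T"] Max_ge[of "(\<lambda>z. z $ i) ` T"] \<open>finite T\<close> \<open>T \<noteq> {}\<close>
    by (smt (verit, best) finite_imageI imageE imageI image_is_empty)
  have "z + axis i 1 \<notin> T" using z(2)[of "z + axis i 1"] by (auto simp: axis_def)
  then have lt: "h (z + axis i 1) < M"
    using le_M'[of "z + axis i 1"] out[of "z + axis i 1"] \<open>0 < M\<close> by (fastforce simp: T_def)
  have "(\<Sum>s\<in>unit_steps. h (z + s)) < (\<Sum>s\<in>(unit_steps :: (int ^ 'd) set). M)"
    by (rule sum_strict_mono_ex1) (use lt in \<open>auto simp: finite_unit_steps le_M' unit_steps_def\<close>)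
  then have "nbr_avg h z < M"
    using card_unit_steps_pos[where 'd = 'd] by (simp add: nbr_avg_def divide_less_eq mult.commute)
  moreover have "h z \<le> nbr_avg h z" using z(1) \<open>0 < M\<close> by (intro sub) (auto simp: T_def)
  ultimately show False using z(1) by (simp add: T_def)
qed

section \<open>Neighbours and reflections in the box\<close>

lemma mem_box_interior_iff: "x \<in> box_interior n \<longleftrightarrow> (\<forall>i. \<bar>x $ i\<bar> < int n)"
proof -
  have "x \<in> box_interior n \<longleftrightarrow> supnorm x < int n"
    by (auto simp: box_interior_def box_boundary_def box_lattice_def)
  then show ?thesis by (simp add: supnorm_def)
qed

lemma finite_box_interior: "finite (box_interior n :: (int ^ 'd::finite) set)"
proof -
  have "(box_interior n :: (int ^ 'd) set) \<subseteq> vec_lambda ` (UNIV \<rightarrow>\<^sub>E {- int n..int n})"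
  proof
    fix x :: "int ^ 'd" assume "x \<in> box_interior n"
    then have "vec_nth x \<in> UNIV \<rightarrow>\<^sub>E {- int n..int n}"
      by (auto simp: mem_box_interior_iff abs_less_iff) (smt (verit))+
    then show "x \<in> vec_lambda ` (UNIV \<rightarrow>\<^sub>E {- int n..int n})"
      by (metis imageI vec_nth_inverse)
  qed
  then show ?thesis
    by (rule finite_subset) (intro finite_imageI finite_PiE; simp)
qed

lemma neighbour_of_interior:
  assumes "x \<in> box_interior n" "s \<in> unit_steps"
  shows "x + s \<in> box_interior n \<union> box_boundary n"
proof -
  have s1: "\<bar>s $ i\<bar> \<le> 1" for i using assms(2) by (auto simp: unit_steps_def axis_def)
  have x1: "\<bar>x $ i\<bar> < int n" for i using assms(1) by (simp add: mem_box_interior_iff)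
  have "\<bar>x $ i + s $ i\<bar> \<le> int n" for i using s1[of i] x1[of i] by linarith
  then have "x + s \<in> box_lattice n" by (simp add: box_lattice_def supnorm_def)
  then show ?thesis by (simp add: box_interior_def)
qed

definition reflect :: "'d \<Rightarrow> int ^ 'd \<Rightarrow> int ^ 'd::finite" where
  "reflect i x = (\<chi> j. if j = i then - (x $ j) else x $ j)"

lemma reflect_add: "reflect i (x + y) = reflect i x + reflect i y"
  by (simp add: reflect_def vec_eq_iff)

lemma reflect_reflect [simp]: "reflect i (reflect i x) = x"
  by (simp add: reflect_def vec_eq_iff)

lemma reflect_mem_box_interior [simp]: "reflect i x \<in> box_interior n \<longleftrightarrow> x \<in> box_interior n"
  by (simp add: mem_box_interior_iff reflect_def) (metis abs_minus_cancel)

lemma reflect_mem_unit_steps: "s \<in> unit_steps \<Longrightarrow> reflect i s \<in> unit_steps"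
proof -
  assume "s \<in> unit_steps"
  then obtain j c where s: "s = axis j c" "c = 1 \<or> c = -1" by (auto simp: unit_steps_def)
  have "reflect i s = axis j (if j = i then - c else c)"
    unfolding s by (simp add: vec_eq_iff reflect_def axis_def)
  then show ?thesis using s(2) by (auto simp: unit_steps_def)
qed

lemma nbr_avg_reflect: "nbr_avg f (reflect i x) = nbr_avg (\<lambda>z. f (reflect i z)) x"
proof -
  have "(\<Sum>s\<in>unit_steps. f (reflect i x + s)) = (\<Sum>s\<in>unit_steps. f (reflect i (x + s)))"
    by (rule sum.reindex_bij_witness[of _ "reflect i" "reflect i"])
      (auto simp: reflect_add reflect_mem_unit_steps)
  then show ?thesis by (simp add: nbr_avg_def)
qed

section \<open>Monotonicity of solutions of the branching equation\<close>

text \<open>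
  Three applications of the maximum principle. First, \<open>u \<le> q\<close> for the \<open>q\<close> of
  \<open>least_fixed_point_of_convex\<close>, because above \<open>q\<close> the equation makes \<open>u\<close> subharmonic; for the
  branching random walk this says that a population confined to the box dies out. On \<open>[0, q]\<close> the
  function \<open>G\<close> does not expand distances, so a positive difference of two solutions is subharmonic.
  Applied to \<open>u\<close> and its mirror image this gives the symmetry of \<open>u\<close>, and applied to \<open>u\<close> and its
  translate by a unit vector it gives the claim.

  Comparing two walks started from \<open>x\<close> and \<open>x + axis i 1\<close> step by step fails when \<open>x $ i = 0\<close>: the step
  in direction \<open>- axis i 1\<close> leads, up to reflection, to the same two sites with their roles exchanged. In
  the maximum principle this exchanged pair is harmless: it contributes the negative of the positive
  quantity being bounded.
\<close>
lemma fixed_point_monotone: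
  fixes u :: "int ^ 'd::finite \<Rightarrow> real" and G :: "real \<Rightarrow> real"
  assumes cvx: "convex_on {0..1} G"
    and mono: "\<And>s t. 0 \<le> s \<Longrightarrow> s \<le> t \<Longrightarrow> t \<le> 1 \<Longrightarrow> G s \<le> G t"
    and G0: "0 \<le> G 0" and G1: "G 1 = 1"
    and u01: "\<And>x. 0 \<le> u x" "\<And>x. u x \<le> 1"
    and off: "\<And>x. x \<notin> box_interior n \<Longrightarrow> u x = 0"
    and eqn: "\<And>x. x \<in> box_interior n \<Longrightarrow> u x = G (nbr_avg u x)"
    and i: "0 \<le> x $ i"
  shows "u (x + axis i 1) \<le> u x"
proof -
  obtain q where q: "0 \<le> q" "q \<le> 1"
    and below: "\<And>s. q \<le> s \<Longrightarrow> s \<le> 1 \<Longrightarrow> G s \<le> s"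
    and lip: "\<And>s t. 0 \<le> s \<Longrightarrow> s \<le> t \<Longrightarrow> t \<le> q \<Longrightarrow> G t - G s \<le> t - s"
    by (rule least_fixed_point_of_convex[of G]) (use cvx mono G0 G1 in blast)+
  have avg0: "0 \<le> nbr_avg u z" for z
    using nbr_avg_mono[of "\<lambda>_. 0" z u] u01 by (simp add: nbr_avg_const)
  have avg1: "nbr_avg u z \<le> 1" for z
    using nbr_avg_mono[of u z "\<lambda>_. 1"] u01 by (simp add: nbr_avg_const)
  \<comment> \<open>The bound \<open>u \<le> q\<close> confines the averages of \<open>u\<close> to the range where \<open>G\<close> is 1-Lipschitz.\<close>
  have u_le_q: "u z \<le> q" for z
  proof -
    have "u z - q \<le> 0"
    proof (rule discrete_maximum_principle[where h = "\<lambda>w. u w - q" and x = z, OF finite_box_interior[of n]])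
      fix z :: "int ^ 'd" assume z: "z \<in> box_interior n" "0 < u z - q"
      have "q < nbr_avg u z"
        using z eqn[OF z(1)] below[of q] mono[of "nbr_avg u z" q] avg0[of z] q by force
      then have "u z \<le> nbr_avg u z" using eqn[OF z(1)] below[of "nbr_avg u z"] avg1 by simp
      then show "u z - q \<le> nbr_avg (\<lambda>w. u w - q) z" by (simp add: nbr_avg_diff nbr_avg_const)
    qed (use off q in auto)
    then show ?thesis by simp
  qed
  have avgq: "nbr_avg u z \<le> q" for z
    using nbr_avg_mono[of u z "\<lambda>_. q"] u_le_q by (simp add: nbr_avg_const)
  have diff_le: "u z - u w \<le> nbr_avg u z - nbr_avg u w"
    if "z \<in> box_interior n" "w \<in> box_interior n" "0 < u z - u w" for z w
  proof -
    have "nbr_avg u w \<le> nbr_avg u z"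
      using that eqn mono[of "nbr_avg u z" "nbr_avg u w"] avg0 avg1 by force
    then show ?thesis using that eqn lip avg0 avgq by simp
  qed
  have refl_le: "u w - u (reflect i w) \<le> 0" for w
  proof (rule discrete_maximum_principle[where h = "\<lambda>w. u w - u (reflect i w)" and x = w, OF finite_box_interior[of n]])
    fix z :: "int ^ 'd" assume z: "z \<in> box_interior n" "0 < u z - u (reflect i z)"
    then show "u z - u (reflect i z) \<le> nbr_avg (\<lambda>w. u w - u (reflect i w)) z"
      using diff_le[of z "reflect i z"] by (simp add: nbr_avg_diff nbr_avg_reflect)
  qed (simp add: off)
  have sym: "u (reflect i z) = u z" for z
    using refl_le[of z] refl_le[of "reflect i z"] by simp
  \<comment> \<open>The half-space below the hyperplane of symmetry is cut off by setting \<open>h = 0\<close> there.\<close>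
  define h where "h z = (if 0 \<le> z $ i then u (z + axis i 1) - u z else 0)" for z
  have "h x \<le> 0"
  proof (rule discrete_maximum_principle[where h = "h" and x = x, OF finite_box_interior[of n]])
    fix z :: "int ^ 'd" assume z: "z \<notin> box_interior n"
    show "h z \<le> 0"
    proof (cases "0 \<le> z $ i")
      case True
      \<comment> \<open>Stepping away from the hyperplane of symmetry cannot enter the box.\<close>
      have "z + axis i 1 \<notin> box_interior n"
      proof
        assume *: "z + axis i 1 \<in> box_interior n"
        have "\<bar>z $ j\<bar> < int n" for j
          using * True unfolding mem_box_interior_iff by (auto simp: axis_def dest!: spec[of _ j] split: if_splits)
        then show False using z by (simp add: mem_box_interior_iff)
      qed
      then show ?thesis using z by (simp add: h_def off)
    qed (simp add: h_def)
  next
    fix z :: "int ^ 'd" assume z: "z \<in> box_interior n" "0 < h z"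
    then have zi: "0 \<le> z $ i" and hz: "h z = u (z + axis i 1) - u z"
      by (auto simp: h_def split: if_splits)
    have "z + axis i 1 \<in> box_interior n"
      using off[of "z + axis i 1"] z(2) u01(1)[of z] hz by fastforce
    then have "h z \<le> nbr_avg u (z + axis i 1) - nbr_avg u z"
      using z diff_le hz by simp
    also have "\<dots> = nbr_avg (\<lambda>w. u (w + axis i 1) - u w) z"
      unfolding nbr_avg_diff by (simp add: nbr_avg_def ac_simps)
    also have "\<dots> \<le> nbr_avg h z"
    proof (rule nbr_avg_mono)
      fix s :: "int ^ 'd" assume s: "s \<in> unit_steps"
      show "u (z + s + axis i 1) - u (z + s) \<le> h (z + s)"
      proof (cases "0 \<le> (z + s) $ i")
        case False
        then have s: "s = axis i (- 1)" and z0: "z $ i = 0"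
          using s zi by (auto simp: unit_steps_def axis_def split: if_splits)
        \<comment> \<open>The exchanged pair: its contribution \<open>- h z\<close> is below the value 0 of \<open>h\<close> at \<open>z + s\<close>.\<close>
        have shift: "z + s + axis i 1 = z" and mirror: "reflect i (z + s) = z + axis i 1"
          using z0 by (auto simp: s vec_eq_iff axis_def reflect_def)
        show ?thesis
          unfolding shift using False z(2) hz sym[of "z + s"] mirror by (simp add: h_def)
      qed (simp add: h_def)
    qed
    finally show "h z \<le> nbr_avg h z" .
  qed
  then show ?thesis using i by (simp add: h_def)
qed

lemma antimono_on_orthant:
  fixes u :: "int ^ 'd::finite \<Rightarrow> real"
  assumes step: "\<And>x i. 0 \<le> x $ i \<Longrightarrow> u (x + axis i 1) \<le> u x"
    and "\<forall>i. 0 \<le> x $ i" "\<forall>i. x $ i \<le> y $ i"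
  shows "u y \<le> u x"
  using assms(2,3)
proof (induction "nat (\<Sum>i\<in>UNIV. y $ i - x $ i)" arbitrary: x rule: less_induct)
  case less
  show ?case
  proof (cases "x = y")
    case False
    then obtain i where i: "x $ i < y $ i"
      using less.prems by (metis order_le_less vec_eq_iff)
    define x' where "x' = x + axis i 1"
    have x'_nth: "x' $ j = x $ j + (if j = i then 1 else 0)" for j
      by (simp add: x'_def axis_def)
    have "(\<Sum>j\<in>UNIV. y $ j - x' $ j) < (\<Sum>j\<in>UNIV. y $ j - x $ j)"
      by (rule sum_strict_mono_ex1) (auto simp: x'_nth)
    moreover have "0 \<le> (\<Sum>j\<in>UNIV. y $ j - x' $ j)"
      using less.prems i by (intro sum_nonneg) (auto simp: x'_nth)
    ultimately have "nat (\<Sum>j\<in>UNIV. y $ j - x' $ j) < nat (\<Sum>j\<in>UNIV. y $ j - x $ j)"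
      by simp
    then have "u y \<le> u x'"
      using less.hyps[of x'] less.prems i by (auto simp: x'_nth)
    also have "\<dots> \<le> u x" unfolding x'_def using less.prems by (intro step) auto
    finally show ?thesis .
  qed simp
qed

section \<open>Decomposition of the branching random walk at its root\<close>

lemma space_brw_space [simp]: "space (brw_space P) = UNIV"
  by (simp add: brw_space_def space_PiM PiE_UNIV_domain)

text \<open>
  Labels list the most recent index first, so the descendants of the \<open>j\<close>-th child of the root are the
  words ending in \<open>j\<close>. The root label of \<open>subtree j \<omega>\<close> carries the step by which this child was
  displaced from its parent.
\<close>
definition subtree :: "nat \<Rightarrow> ('d::finite) brw_outcome \<Rightarrow> 'd brw_outcome" where
  "subtree j \<omega> = (\<lambda>u. \<omega> (u @ [j]))"

definition avoid :: "nat \<Rightarrow> int ^ 'd \<Rightarrow> ('d::finite) brw_outcome set" where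
  "avoid n z = {\<omega>. \<forall>u. born \<omega> u \<longrightarrow> site z \<omega> u \<notin> box_boundary n}"

text \<open>
  For a child of the site \<open>z\<close>: its subtree is a branching random walk preceded by the step that leads
  from \<open>z\<close> to the child, and that step is stored at the root label of the subtree.
\<close>
definition avoid_after_step :: "nat \<Rightarrow> int ^ 'd \<Rightarrow> ('d::finite) brw_outcome set" where
  "avoid_after_step n z = {\<omega>. \<omega> \<in> avoid n (z + snd (\<omega> []))}"

lemma born_snoc: "born \<omega> (u @ [j]) \<longleftrightarrow> j < fst (\<omega> []) \<and> born (subtree j \<omega>) u"
  by (induction u) (auto simp: subtree_def)

lemma site_snoc: "site z \<omega> (u @ [j]) = site (z + snd (subtree j \<omega> [])) (subtree j \<omega>) u"
  by (induction u) (auto simp: subtree_def)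

text \<open>
  The hypothesis settles the root itself; every other label ends in the index of a child of the root.
\<close>
lemma avoid_iff_subtrees:
  assumes "z \<notin> box_boundary n"
  shows "\<omega> \<in> avoid n z \<longleftrightarrow> (\<forall>j<fst (\<omega> []). subtree j \<omega> \<in> avoid_after_step n z)"
proof -
  have "\<omega> \<in> avoid n z \<longleftrightarrow> (\<forall>j u. born \<omega> (u @ [j]) \<longrightarrow> site z \<omega> (u @ [j]) \<notin> box_boundary n)"
    using assms unfolding avoid_def mem_Collect_eq
    by (metis rev_exhaust site.simps(1))
  then show ?thesis
    by (auto simp: born_snoc site_snoc avoid_after_step_def avoid_def)
qed

lemma avoid_boundary: "z \<in> box_boundary n \<Longrightarrow> avoid n z = {}"
  by (force simp: avoid_def intro!: exI[of _ "[]"])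

lemma avoid_eq: "avoid n z = space (brw_space P) - {\<omega> \<in> space (brw_space P). hitting_time n z \<omega> < \<infinity>}"
  by (auto simp: avoid_def hitting_time_finite_iff simp del: enat_ord_simps)

lemma sets_avoid [measurable]: "avoid n z \<in> sets (brw_space P)"
  unfolding avoid_eq[of n z P] by (intro sets.compl_sets sets_hitting)

lemma hitting_prob_eq: "hitting_prob P n z = 1 - measure (brw_space P) (avoid n z)"
proof -
  interpret prob_space "brw_space P" by (rule prob_space_brw_space)
  show ?thesis
    unfolding hitting_prob_def avoid_eq[of n z P] by (simp only: prob_compl[OF sets_hitting])
qed

lemma sets_root [measurable]: "{\<omega>. Q (\<omega> [])} \<in> sets (brw_space P)"
  using measurable_sets[OF measurable_component, of "{a. Q a}" "[]" P] by (simp add: vimage_def)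

lemma sets_avoid_after_step [measurable]: "avoid_after_step n z \<in> sets (brw_space P)"
proof -
  have "avoid_after_step n z = (\<Union>s. {\<omega>. snd (\<omega> []) = s} \<inter> avoid n (z + s))"
    by (auto simp: avoid_after_step_def)
  also have "\<dots> \<in> sets (brw_space P)"
    by (intro sets.countable_UN' sets.Int sets_avoid sets_root) auto
  finally show ?thesis .
qed

lemma measurable_subtree_restrict:
  "(\<lambda>f u. f (u @ [j])) \<in> (\<Pi>\<^sub>M u\<in>range (\<lambda>u. u @ [j]). measure_pmf (pair_pmf P (pmf_of_set unit_steps)))
     \<rightarrow>\<^sub>M brw_space P"
  unfolding brw_space_def
  by (intro measurable_PiM_single' measurable_component_singleton) auto

lemma measurable_subtree [measurable]: "subtree j \<in> brw_space P \<rightarrow>\<^sub>M brw_space P"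
  unfolding brw_space_def subtree_def[abs_def]
  by (intro measurable_PiM_single' measurable_component_singleton) (auto simp: space_PiM)

lemma distr_subtree: "distr (brw_space P) (brw_space P) (subtree j) = brw_space P"
  unfolding brw_space_def subtree_def[abs_def]
  using distr_PiM_reindex[of UNIV "\<lambda>_. measure_pmf (pair_pmf P (pmf_of_set unit_steps))" "\<lambda>u. u @ [j]" UNIV]
  by (simp add: prob_space_measure_pmf inj_def restrict_def)

lemma distr_root:
  "distr (brw_space P) (measure_pmf (pair_pmf P (pmf_of_set unit_steps))) (\<lambda>\<omega>. \<omega> []) = pair_pmf P (pmf_of_set unit_steps)"
  unfolding brw_space_def by (intro distr_PiM_component prob_space_measure_pmf) auto

lemma indep_labels:
  "prob_space.indep_vars (brw_space P) (\<lambda>_. measure_pmf (pair_pmf P (pmf_of_set unit_steps))) (\<lambda>u \<omega>. \<omega> u) UNIV"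
proof -
  let ?N = "measure_pmf (pair_pmf P (pmf_of_set (unit_steps :: (int ^ 'a) set)))"
  have "(\<lambda>u. distr (\<Pi>\<^sub>M u\<in>UNIV. ?N) ?N (\<lambda>\<omega>. \<omega> u)) = (\<lambda>u :: nat list. ?N)"
    by (intro ext distr_PiM_component prob_space_measure_pmf) auto
  then show ?thesis
    unfolding brw_space_def
    by (subst prob_space.indep_vars_iff_distr_eq_PiM'[OF prob_space_brw_space[of P, unfolded brw_space_def]])
      (simp_all add: restrict_def distr_id[unfolded id_def])
qed

text \<open>
  The label of the root and the words ending in \<open>0\<close>, \<open>1\<close>, and so on form disjoint blocks of labels, so the
  root and the subtrees are independent, and each subtree is distributed as the whole tree.
\<close>
lemma prob_root_subtrees:
  assumes E: "E \<in> sets (brw_space P)"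
  shows "measure (brw_space P) {\<omega>. \<omega> [] \<in> A \<and> (\<forall>j<k. subtree j \<omega> \<in> E)} =
    measure_pmf.prob (pair_pmf P (pmf_of_set unit_steps)) A * measure (brw_space P) E ^ k"
proof -
  interpret prob_space "brw_space P" by (rule prob_space_brw_space)
  let ?M = "\<lambda>_ :: nat list. measure_pmf (pair_pmf P (pmf_of_set (unit_steps :: (int ^ 'a) set)))"
  (* Block 0 is the root label, block j + 1 belongs to the child j. *)
  define K :: "nat \<Rightarrow> nat list set" where
    "K i = (case i of 0 \<Rightarrow> {[]} | Suc j \<Rightarrow> range (\<lambda>u. u @ [j]))" for i
  define F where "F i = (case i of 0 \<Rightarrow> {f \<in> space (PiM (K 0) ?M). f [] \<in> A}
    | Suc j \<Rightarrow> (\<lambda>f u. f (u @ [j])) -` E \<inter> space (PiM (K (Suc j)) ?M))" for i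
  define R where "R i = (case i of 0 \<Rightarrow> {\<omega>. \<omega> [] \<in> A} | Suc j \<Rightarrow> {\<omega>. subtree j \<omega> \<in> E})" for i
  have "disjoint_family_on K UNIV"
    by (auto simp: disjoint_family_on_def K_def split: nat.splits)
  then have ind: "indep_vars (\<lambda>i. PiM (K i) ?M) (\<lambda>i \<omega>. restrict (\<lambda>u. \<omega> u) (K i)) UNIV"
    by (intro indep_vars_restrict[OF indep_labels]) auto
  have "F i \<in> sets (PiM (K i) ?M)" for i
  proof (cases i)
    case 0
    have "(\<lambda>f. f []) \<in> PiM (K 0) ?M \<rightarrow>\<^sub>M ?M []"
      by (rule measurable_component_singleton) (simp add: K_def)
    from measurable_sets[OF this, of A] show ?thesis
      by (simp add: 0 F_def vimage_def Int_def conj_commute)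
  next
    case (Suc j)
    show ?thesis
      using measurable_sets[OF measurable_subtree_restrict E, of j] by (simp add: Suc F_def K_def)
  qed
  then have "prob (\<Inter>i\<in>{..<Suc k}. (\<lambda>\<omega>. restrict (\<lambda>u. \<omega> u) (K i)) -` F i \<inter> space (brw_space P)) =
      (\<Prod>i<Suc k. prob ((\<lambda>\<omega>. restrict (\<lambda>u. \<omega> u) (K i)) -` F i \<inter> space (brw_space P)))"
    by (intro indep_varsD[OF ind]) auto
  moreover have "(\<lambda>\<omega>. restrict (\<lambda>u. \<omega> u) (K i)) -` F i \<inter> space (brw_space P) = R i" for i
    by (auto simp: F_def K_def R_def space_PiM subtree_def split: nat.splits)
  ultimately have "prob (\<Inter>i\<in>{..<Suc k}. R i) = (\<Prod>i<Suc k. prob (R i))"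
    by simp
  moreover have "(\<Inter>i\<in>{..<Suc k}. R i) = {\<omega>. \<omega> [] \<in> A \<and> (\<forall>j<k. subtree j \<omega> \<in> E)}"
    by (auto simp: lessThan_Suc_eq_insert_0 R_def)
  moreover have "(\<Prod>i<Suc k. prob (R i)) = prob (R 0) * (\<Prod>j<k. prob (R (Suc j)))"
    by (rule prod.lessThan_Suc_shift)
  moreover have "prob (R 0) = measure_pmf.prob (pair_pmf P (pmf_of_set unit_steps)) A"
  proof -
    have "(\<lambda>\<omega> :: 'a brw_outcome. \<omega> []) \<in> brw_space P \<rightarrow>\<^sub>M measure_pmf (pair_pmf P (pmf_of_set unit_steps))"
      using measurable_component by (simp cong: measurable_cong_sets)
    from measure_distr[OF this, of A] show ?thesis
      unfolding distr_root by (simp add: R_def vimage_def)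
  qed
  moreover have "prob (R (Suc j)) = prob E" for j
    using measure_distr[OF measurable_subtree E, of j] unfolding distr_subtree
    by (simp add: R_def vimage_def)
  ultimately show ?thesis
    by simp
qed

text \<open>
  The boundary is avoided if and only if it is avoided by each of the \<open>k\<close> subtrees at the root, where
  \<open>k\<close> follows the offspring law; summing \<open>P k * e ^ k\<close> gives the generating function at \<open>e\<close>. The
  displacement at the root is carried along to show that it is independent of this event.
\<close>
lemma prob_avoid_root_step:
  assumes "z \<notin> box_boundary n"
  shows "measure (brw_space P) {\<omega> \<in> avoid n z. snd (\<omega> []) \<in> A} =
    measure_pmf.prob (pmf_of_set unit_steps) A * pgf P (measure (brw_space P) (avoid_after_step n z))"
proof -
  interpret prob_space "brw_space P" by (rule prob_space_brw_space)
  define D where "D k = {\<omega>. \<omega> [] \<in> {k} \<times> A \<and> (\<forall>j<k. subtree j \<omega> \<in> avoid_after_step n z)}" for k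
  have "range D \<subseteq> events"
  proof safe
    fix k
    have "{\<omega> \<in> space (brw_space P). \<forall>j\<in>{..<k}. subtree j \<omega> \<in> avoid_after_step n z} \<in> events"
      by measurable
    moreover have "{\<omega>. \<omega> [] \<in> {k} \<times> A} \<in> events"
      by (rule sets_root)
    moreover have "D k = {\<omega>. \<omega> [] \<in> {k} \<times> A} \<inter>
        {\<omega> \<in> space (brw_space P). \<forall>j\<in>{..<k}. subtree j \<omega> \<in> avoid_after_step n z}"
      by (auto simp: D_def)
    ultimately show "D k \<in> events"
      by simp
  qed
  moreover have "disjoint_family D"
    by (auto simp: disjoint_family_on_def D_def)
  ultimately have "(\<lambda>k. prob (D k)) sums prob (\<Union>k. D k)"
    by (rule finite_measure_UNION)
  moreover have "prob (D k) = measure_pmf.prob (pmf_of_set unit_steps) A * (pmf P k * prob (avoid_after_step n z) ^ k)" for k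
    unfolding D_def
    by (subst prob_root_subtrees)
      (simp_all add: sets_avoid_after_step measure_pmf_prob_product measure_pmf_single)
  moreover have "(\<Union>k. D k) = {\<omega> \<in> avoid n z. snd (\<omega> []) \<in> A}"
    using avoid_iff_subtrees[OF assms] by (auto simp: D_def mem_Times_iff)
  moreover have "(\<lambda>k. measure_pmf.prob (pmf_of_set (unit_steps :: (int^'a) set)) A * (pmf P k * prob (avoid_after_step n z) ^ k)) sums
     (measure_pmf.prob (pmf_of_set unit_steps) A * pgf P (prob (avoid_after_step n z)))"
    by (intro sums_mult pgf_sums) auto
  ultimately show ?thesis
    by (simp add: sums_unique2)
qed

lemma prob_avoid:
  "z \<notin> box_boundary n \<Longrightarrow>
    measure (brw_space P) (avoid n z) = pgf P (measure (brw_space P) (avoid_after_step n z))"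
  using prob_avoid_root_step[of z n P UNIV] by simp

text \<open>
  Conditioning on the first step, which is uniform on the unit steps and independent of the walk that
  follows it.
\<close>
lemma prob_avoid_after_step:
  fixes z :: "int ^ 'd::finite"
  shows "measure (brw_space P) (avoid_after_step n z) =
    nbr_avg (\<lambda>w. measure (brw_space P) (avoid n w)) z"
proof -
  interpret prob_space "brw_space P" by (rule prob_space_brw_space)
  let ?U = "unit_steps :: (int ^ 'd) set"
  define B where "B s = {\<omega> \<in> avoid n (z + s). snd (\<omega> []) \<in> {s}}" for s
  have B: "B s \<in> events" for s
    unfolding B_def Collect_conj_eq by (intro sets.Int sets_root) simp
  have "AE \<omega> in brw_space P. snd (\<omega> []) \<in> ?U"
  proof -
    \<comment> \<open>Outcomes with other displacements exist but have probability 0.\<close>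
    have "AE a in measure_pmf (pair_pmf P (pmf_of_set ?U)). snd a \<in> ?U"
      by (auto simp: AE_measure_pmf_iff set_pmf_of_set finite_unit_steps unit_steps_nonempty)
    then show ?thesis
      unfolding brw_space_def by (intro AE_PiM_component prob_space_measure_pmf) auto
  qed
  then have "AE \<omega> in brw_space P. \<omega> \<in> avoid_after_step n z \<longleftrightarrow> \<omega> \<in> (\<Union>s\<in>?U. B s)"
    by eventually_elim (auto simp: avoid_after_step_def B_def)
  then have "prob (avoid_after_step n z) = prob (\<Union>s\<in>?U. B s)"
    using B by (intro finite_measure_eq_AE) (auto simp: finite_unit_steps intro: sets_avoid_after_step)
  also have "\<dots> = (\<Sum>s\<in>?U. prob (B s))"
    using B by (intro finite_measure_finite_Union) (auto simp: finite_unit_steps disjoint_family_on_def B_def)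
  also have "\<dots> = (\<Sum>s\<in>?U. prob (avoid n (z + s)) / card ?U)"
  proof (rule sum.cong)
    fix s assume s: "s \<in> ?U"
    show "prob (B s) = prob (avoid n (z + s)) / card ?U"
    proof (cases "z + s \<in> box_boundary n")
      case True
      then show ?thesis by (simp add: B_def avoid_boundary)
    next
      case False
      show ?thesis
        unfolding B_def prob_avoid_root_step[OF False] prob_avoid[OF False]
        using s by (simp add: measure_pmf_of_set finite_unit_steps unit_steps_nonempty)
    qed
  qed simp
  finally show ?thesis by (simp add: nbr_avg_def sum_divide_distrib)
qed

section \<open>Monotonicity of the hitting probability\<close>

theorem theorem2:
  fixes P :: "nat pmf" and n :: nat and x y :: "int ^ 'd"
  assumes "n \<ge> 1"
    and "x \<in> nonneg_orthant \<inter> box_interior n"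
    and "y \<in> nonneg_orthant \<inter> box_interior n"
    and "\<forall>i. x $ i \<le> y $ i"
  shows "hitting_prob P n x \<le> hitting_prob P n y"
proof -
  interpret prob_space "brw_space P :: 'd brw_outcome measure" by (rule prob_space_brw_space)
  define u :: "int ^ 'd \<Rightarrow> real" where
    "u z = (if z \<in> box_interior n then prob (avoid n z) else 0)" for z
  have eqn: "u z = pgf P (nbr_avg u z)" if z: "z \<in> box_interior n" for z
  proof -
    have "prob (avoid n (z + s)) = u (z + s)" if "s \<in> unit_steps" for s
      using neighbour_of_interior[OF z that] by (auto simp: u_def avoid_boundary)
    then have "nbr_avg (\<lambda>w. prob (avoid n w)) z = nbr_avg u z"
      by (simp add: nbr_avg_def)
    moreover have "z \<notin> box_boundary n"
      using z by (simp add: box_interior_def)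
    ultimately show ?thesis
      using z by (simp add: u_def prob_avoid prob_avoid_after_step)
  qed
  have u01: "0 \<le> u z" "u z \<le> 1" and off: "z \<notin> box_interior n \<Longrightarrow> u z = 0" for z
    by (auto simp: u_def)
  have "u (z + axis i 1) \<le> u z" if "0 \<le> z $ i" for z i
    by (rule fixed_point_monotone[where G = "pgf P" and n = n])
      (use that eqn u01 off in \<open>auto intro: convex_on_pgf pgf_mono pgf_nonneg simp: pgf_1\<close>)
  then have "u y \<le> u x"
    by (rule antimono_on_orthant) (use assms in \<open>auto simp: nonneg_orthant_def\<close>)
  then show ?thesis
    using assms by (simp add: u_def hitting_prob_eq)
qed

end
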